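(* $S_{\triangle}(3)=1$, $S_{\triangle}(4)=4$, $S_{\triangle}(5)=8$, $S_{\triangle}(6)=11$, $S_{\triangle}(7)=15$, $S_{\triangle}(8)=20$, and $S_{\triangle}(9)=28$.
   Context: For a finite set $P$ of points in the Euclidean plane, $S_{\triangle}(P)$ denotes the number of (unordered) triplets of points of $P$ that are the vertices of an isosceles right triangle (nondegenerate, of any size and orientation). For a positive integer $n$, $S_{\triangle}(n)=\max_{|P|=n}S_{\triangle}(P)$, the maximum being over all sets $P$ of $n$ points in the plane. *)

theory Defs
  imports "HOL-Analysis.Analysis"
begin

definition isosceles_right_triangle :: "(real ^ 2) set \<Rightarrow> bool" where
  "isosceles_right_triangle T \<longleftrightarrow>
     (\<exists>a b c. T = {a, b, c} \<and> \<not> collinear {a, b, c} \<and>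
        orthogonal (b - a) (c - a) \<and> dist a b = dist a c)"

definition S_tri_of :: "(real ^ 2) set \<Rightarrow> nat" where
  "S_tri_of P = card {T. T \<subseteq> P \<and> isosceles_right_triangle T}"

definition S_tri :: "nat \<Rightarrow> nat" where
  "S_tri n = Max {S_tri_of P | P. finite P \<and> card P = n}"

lemma isosceles_right_triangle_card:
  assumes "isosceles_right_triangle T"
  shows "card T = 3"
proof -
  obtain a b c where T: "T = {a, b, c}" and nc: "\<not> collinear {a, b, c}"
    using assms unfolding isosceles_right_triangle_def by blast
  have "a \<noteq> b" "a \<noteq> c" "b \<noteq> c"
    using nc by (auto simp: insert_commute)
  then show ?thesis using T by simp
qed

(* The set whose maximum defines S_tri n is finite and nonempty, so Max is the actual maximum. *)

lemma S_tri_of_le: "finite P \<Longrightarrow> S_tri_of P \<le> 2 ^ card P"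
  unfolding S_tri_of_def
  by (metis (no_types, lifting) Pow_iff card_Pow card_mono finite_Pow_iff mem_Collect_eq subsetI)

lemma finite_S_tri_values: "finite {S_tri_of P | P. finite P \<and> card P = n}"
  by (rule finite_subset[of _ "{..2 ^ n}"]) (auto dest: S_tri_of_le)

lemma S_tri_values_nonempty: "{S_tri_of P | P. finite P \<and> card P = n} \<noteq> {}"
proof -
  have "infinite (UNIV :: (real ^ 2) set)"
    using not_bounded_UNIV finite_imp_bounded by blast
  then obtain P :: "(real ^ 2) set" where "finite P" "card P = n"
    using infinite_arbitrarily_large by blast
  then show ?thesis by blast
qed

end

theory Submission
  imports Defs
begin

text \<open>Removing a point of minimal degree from \<open>n\<close> points with \<open>t\<close> triangles leaves at least
  \<open>t - 3t/n\<close> triangles. Hence 9 points with 29 triangles would contain 8 points with 20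
  triangles, and these 7 points with 13, 6 points with 8, 5 points with 4 and 4 points with 2
  triangles. Conversely, a point that forms a triangle with two points of a given set is one of
  finitely many, so all sets reaching these thresholds are found, up to similarity, by adding such
  points one at a time; they all consist of Gaussian integers, and the search stops before 29
  triangles on 9 points. An added point of degree 0 can only occur over an extremal set on 4 or 5
  points; then another point can be removed instead.\<close>

subsection \<open>Isosceles right triangles in the complex plane\<close>

text \<open>The quarter turn about \<open>a\<close> is affine in both arguments, so being an
  isosceles right triangle becomes a linear condition on the vertices \<open>a\<close>,
  \<open>b\<close>, \<open>turn a b\<close>. The inverse \<open>turn'\<close> recovers
  \<open>b\<close> from \<open>a\<close> and the third vertex.\<close>

definition turn :: "complex \<Rightarrow> complex \<Rightarrow> complex" where
  "turn a b = a + \<i> * (b - a)"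

definition turn' :: "complex \<Rightarrow> complex \<Rightarrow> complex" where
  "turn' a b = a - \<i> * (b - a)"

definition legs :: "complex set \<Rightarrow> (complex \<times> complex) set" where
  "legs P = {(a, b). a \<in> P \<and> b \<in> P \<and> a \<noteq> b \<and> turn a b \<in> P}"

text \<open>A triangle is counted through its right-angle vertex \<open>a\<close> and that end \<open>b\<close> of a leg
  for which the other end is the counterclockwise one, so each triangle is counted once.\<close>

definition num_tri :: "complex set \<Rightarrow> nat" where
  "num_tri P = card (legs P)"

lemma turn_simps [simp]:
  "turn a (turn' a b) = b" "turn' a (turn a b) = b"
  "turn a b = a \<longleftrightarrow> b = a" "turn' a b = a \<longleftrightarrow> b = a" 
  "turn a b = b \<longleftrightarrow> b = a" "turn' a b = b \<longleftrightarrow> b = a"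
  "turn a a = a" "turn' a a = a"
  "a = turn a b \<longleftrightarrow> b = a" "b = turn a b \<longleftrightarrow> b = a" "a = turn' a b \<longleftrightarrow> b = a"
  by (auto simp: turn_def turn'_def algebra_simps complex_eq_iff)

lemma finite_legs: "finite P \<Longrightarrow> finite (legs P)"
  by (rule finite_subset[of _ "P \<times> P"]) (auto simp: legs_def)

lemma num_tri_mono: "finite Q \<Longrightarrow> P \<subseteq> Q \<Longrightarrow> num_tri P \<le> num_tri Q"
  unfolding num_tri_def by (intro card_mono finite_legs) (auto simp: legs_def)

text \<open>The new triangles are sorted by the role of \<open>q\<close>: right-angle vertex,
  clockwise end of a leg, or counterclockwise end. In the last role the clockwise end is
  \<open>turn' a q\<close>.\<close>

lemma num_tri_insert:
  assumes D: "finite D" "q \<notin> D"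
  shows "num_tri (insert q D) = num_tri D + card {b \<in> D. turn q b \<in> D} + card {a \<in> D. turn a q \<in> D}
      + card {a \<in> D. turn' a q \<in> D}"
proof -
  let ?A = "Pair q ` {b \<in> D. turn q b \<in> D}"
  let ?B = "(\<lambda>a. (a, q)) ` {a \<in> D. turn a q \<in> D}"
  let ?C = "(\<lambda>a. (a, turn' a q)) ` {a \<in> D. turn' a q \<in> D}"
  have "legs (insert q D) = legs D \<union> ?A \<union> ?B \<union> ?C"
  proof (intro equalityI subsetI)
    fix e assume "e \<in> legs (insert q D)"
    then obtain a b where e: "e = (a, b)" "a \<in> insert q D" "b \<in> insert q D" "a \<noteq> b"
        "turn a b \<in> insert q D"
      by (auto simp: legs_def)
    consider "a = q" | "b = q" | "a \<noteq> q" "b \<noteq> q" "turn a b = q"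
      | "a \<noteq> q" "b \<noteq> q" "turn a b \<in> D"
      using e by blast
    then show "e \<in> legs D \<union> ?A \<union> ?B \<union> ?C"
    proof cases
      case 3
      then have "b = turn' a q" by auto
      with 3 e show ?thesis by auto
    qed (use e in \<open>auto simp: legs_def\<close>)
  next
    fix e assume "e \<in> legs D \<union> ?A \<union> ?B \<union> ?C"
    then show "e \<in> legs (insert q D)"
      using D by (elim UnE) (auto simp: legs_def)
  qed
  moreover have "legs D \<inter> ?A = {}" "(legs D \<union> ?A) \<inter> ?B = {}" "(legs D \<union> ?A \<union> ?B) \<inter> ?C = {}"
    using D by (auto simp: legs_def)
  ultimately have "num_tri (insert q D) = card (legs D) + card ?A + card ?B + card ?C"
    unfolding num_tri_def using D finite_legs[of D] by (simp add: card_Un_disjoint)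
  then show ?thesis
    by (simp add: num_tri_def card_image inj_on_def)
qed

text \<open>Double counting: the degrees sum to three times the number of triangles, so some point
  has at most the average degree. Multiplying by \<open>card P\<close> avoids division.\<close>

lemma exists_low_degree_point:
  assumes P: "finite P" "P \<noteq> {}"
  shows "\<exists>p\<in>P. card P * num_tri P \<le> 3 * num_tri P + card P * num_tri (P - {p})"
proof (rule ccontr)
  define T where "T e = {fst e, snd e, turn (fst e) (snd e)}" for e
  define R where "R p = {e \<in> legs P. p \<in> T e}" for p
  assume "\<not> ?thesis"
  then have *: "3 * num_tri P + card P * num_tri (P - {p}) < card P * num_tri P" if "p \<in> P" for p
    using that by auto
  \<comment> \<open>Deleting \<open>p\<close> destroys precisely the triangles in
    \<open>R p\<close>, so \<open>card (R p)\<close> is the degree of \<open>p\<close>.\<close>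
  have R: "num_tri P = num_tri (P - {p}) + card (R p)" for p
  proof -
    have "legs P = legs (P - {p}) \<union> R p" "legs (P - {p}) \<inter> R p = {}"
      by (auto simp: legs_def R_def T_def)
    moreover have "finite (legs (P - {p}))" "finite (R p)"
      using P finite_legs by (auto simp: R_def)
    ultimately show ?thesis
      unfolding num_tri_def by (metis card_Un_disjoint)
  qed
  have "(\<Sum>p\<in>P. card (R p)) = (\<Sum>p\<in>P. \<Sum>e\<in>legs P. of_bool (p \<in> T e))"
    using finite_legs[OF P(1)] by (simp add: R_def Int_def)
  also have "\<dots> = (\<Sum>e\<in>legs P. \<Sum>p\<in>P. of_bool (p \<in> T e))"
    by (rule sum.swap)
  also have "\<dots> = (\<Sum>e\<in>legs P. 3)"
  proof (rule sum.cong)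
    fix e assume "e \<in> legs P"
    then have "P \<inter> T e = T e" "card (T e) = 3"
      by (auto simp: legs_def T_def card_insert_if)
    then show "(\<Sum>p\<in>P. of_bool (p \<in> T e)) = (3::nat)"
      using P by (simp add: Int_def)
  qed simp
  finally have sum: "(\<Sum>p\<in>P. card (R p)) = 3 * num_tri P"
    by (simp add: num_tri_def)
  have "3 * num_tri P < card P * card (R p)" if "p \<in> P" for p
  proof -
    have "card P * num_tri P = card P * num_tri (P - {p}) + card P * card (R p)"
      using R[of p] by (metis distrib_left)
    then show ?thesis using *[OF that] by linarith
  qed
  then have "(\<Sum>p\<in>P. 3 * num_tri P) < (\<Sum>p\<in>P. card P * card (R p))"
    using P by (intro sum_strict_mono) auto
  also have "\<dots> = card P * (3 * num_tri P)"
    using sum by (simp add: sum_distrib_left[symmetric])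
  finally show False by simp
qed

section \<open>Passage from the real plane to the complex plane\<close>

definition to_complex :: "real ^ 2 \<Rightarrow> complex" where
  "to_complex v = Complex (v $ 1) (v $ 2)"

lemma to_complex_eq_iff [simp]: "to_complex u = to_complex v \<longleftrightarrow> u = v"
  by (auto simp: to_complex_def vec_eq_iff forall_2)

lemma to_complex_surj: "\<exists>v. to_complex v = z"
  by (rule exI[of _ "vector [Re z, Im z]"]) (simp add: to_complex_def complex_eq_iff)

definition turn_triangle :: "complex set \<Rightarrow> bool" where
  "turn_triangle T \<longleftrightarrow> (\<exists>a b. a \<noteq> b \<and> T = {a, b, turn a b})"

text \<open>A triangle determines its pair in \<open>legs\<close>: the right-angle vertex is unique,
  and the orientation fixes the order of the other two.\<close>

lemma num_tri_eq_card_triangles: "num_tri Q = card {T. T \<subseteq> Q \<and> turn_triangle T}"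
proof -
  have inj: "inj_on (\<lambda>(a, b). {a, b, turn a b}) (legs Q)"
  proof (rule inj_onI, clarify)
    fix a b c d
    assume ab: "(a, b) \<in> legs Q" and cd: "(c, d) \<in> legs Q"
      and eq: "{a, b, turn a b} = {c, d, turn c d}"
    define z where "z = b - a"
    have z: "z \<noteq> 0" "b = a + 1 * z" "turn a b = a + \<i> * z" and "c \<noteq> d"
      using ab cd by (auto simp: legs_def z_def turn_def)
    have *: "\<exists>u\<in>{0, 1, \<i>}. w = a + u * z" if "w \<in> {c, d, turn c d}" for w
      using that unfolding eq[symmetric] z(3) by (auto simp: z(2))
    obtain u where c: "u \<in> {0, 1, \<i>}" "c = a + u * z" using *[of c] by blast
    obtain v where d: "v \<in> {0, 1, \<i>}" "d = a + v * z" using *[of d] by blast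
    obtain w where t: "w \<in> {0, 1, \<i>}" "turn c d = a + w * z" using *[of "turn c d"] by blast
    from t(2) have "(u + \<i> * (v - u)) * z = w * z"
      unfolding c(2) d(2) turn_def by (simp add: algebra_simps)
    then have "u + \<i> * (v - u) = w"
      using z(1) by simp
    moreover have "u \<noteq> v" using \<open>c \<noteq> d\<close> c(2) d(2) by auto
    \<comment> \<open>Of the six ordered pairs of distinct points of {0, 1, i}, only (0, 1) is
      turned into a point of that set.\<close>
    ultimately have "u = 0 \<and> v = 1"
      using c(1) d(1) t(1) by (auto simp: complex_eq_iff)
    then show "a = c \<and> b = d"
      using c(2) d(2) z(2) by simp
  qed
  have "(\<lambda>(a, b). {a, b, turn a b}) ` legs Q = {T. T \<subseteq> Q \<and> turn_triangle T}"
  proof (intro equalityI subsetI)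
    fix T assume "T \<in> {T. T \<subseteq> Q \<and> turn_triangle T}"
    then obtain a b where "a \<noteq> b" "T = {a, b, turn a b}" "T \<subseteq> Q"
      by (auto simp: turn_triangle_def)
    then have "(a, b) \<in> legs Q" "T = (\<lambda>(a, b). {a, b, turn a b}) (a, b)"
      by (auto simp: legs_def)
    then show "T \<in> (\<lambda>(a, b). {a, b, turn a b}) ` legs Q" by blast
  qed (auto simp: legs_def turn_triangle_def)
  with card_image[OF inj] show ?thesis
    by (simp add: num_tri_def)
qed

text \<open>A vector orthogonal to (p, q) is a multiple of (-q, p), and equal length forces the
  factor to be 1 or -1.\<close>

lemma right_isosceles_iff:
  fixes p q s t :: real
  assumes "p \<noteq> 0 \<or> q \<noteq> 0"
  shows "p * s + q * t = 0 \<and> p\<^sup>2 + q\<^sup>2 = s\<^sup>2 + t\<^sup>2 \<longleftrightarrow>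
    (s = - q \<and> t = p) \<or> (s = q \<and> t = - p)"
proof
  assume *: "p * s + q * t = 0 \<and> p\<^sup>2 + q\<^sup>2 = s\<^sup>2 + t\<^sup>2"
  define r where "r = p\<^sup>2 + q\<^sup>2"
  have pos: "r \<noteq> 0" using assms by (simp add: r_def sum_power2_eq_zero_iff)
  \<comment> \<open>The coefficient of (s, t) along (-q, p): their inner product divided by the
    squared length.\<close>
  define k where "k = (p * t - q * s) / r"
  have "s * r = - q * (p * t - q * s)" "t * r = p * (p * t - q * s)"
    using * unfolding r_def by algebra+
  then have s: "s = - q * k" and t: "t = p * k"
    using pos unfolding k_def by (simp_all add: field_simps)
  have "s\<^sup>2 + t\<^sup>2 = r * k\<^sup>2"
    unfolding s t r_def by (simp add: power_mult_distrib algebra_simps)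
  then have "r * k\<^sup>2 = r"
    using * by (simp add: r_def)
  then have "k\<^sup>2 = 1" using pos by simp
  then have "k = 1 \<or> k = -1" by (simp add: power2_eq_1_iff)
  then show "(s = - q \<and> t = p) \<or> (s = q \<and> t = - p)" using s t by auto
qed auto

text \<open>Collinear legs would be parallel, and parallel orthogonal legs of equal length have
  length zero. The disjunction reflects the two orientations in which \<open>b\<close> and
  \<open>c\<close> can follow each other around \<open>a\<close>.\<close>

lemma isosceles_right_iff:
  "\<not> collinear {a, b, c} \<and> orthogonal (b - a) (c - a) \<and> dist a b = dist a c \<longleftrightarrow>
   a \<noteq> b \<and> (to_complex c = turn (to_complex a) (to_complex b) \<or> to_complex b = turn (to_complex a) (to_complex c))"
  (is "?L \<longleftrightarrow> ?R")
  for a b c :: "real ^ 2"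
proof (cases "a = b")
  case False
  define p q s t where "p = b $ 1 - a $ 1" "q = b $ 2 - a $ 2" "s = c $ 1 - a $ 1" "t = c $ 2 - a $ 2"
  note defs = this
  have pq: "p \<noteq> 0 \<or> q \<noteq> 0" using False by (auto simp: defs vec_eq_iff forall_2)
  have o: "orthogonal (b - a) (c - a) \<longleftrightarrow> p * s + q * t = 0"
    by (simp add: orthogonal_def inner_vec_def sum_2 defs)
  have d: "dist a b = dist a c \<longleftrightarrow> p\<^sup>2 + q\<^sup>2 = s\<^sup>2 + t\<^sup>2"
    by (simp add: dist_vec_def L2_set_def sum_2 defs dist_real_def
      power2_commute[of "a $ 1"] power2_commute[of "a $ 2"])
  have c: "\<not> collinear {a, b, c}" if "p * s + q * t = 0" "p\<^sup>2 + q\<^sup>2 = s\<^sup>2 + t\<^sup>2"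
  proof
    assume "collinear {a, b, c}"
    then have "collinear {0, b - a, c - a}"
      using collinear_3[of b a c] by (simp add: insert_commute)
    moreover have "b - a \<noteq> 0" "c - a \<noteq> 0"
      using False d that by auto
    ultimately obtain k where "c - a = k *\<^sub>R (b - a)"
      by (auto simp: collinear_lemma)
    then have "(c - a) $ i = k * (b - a) $ i" for i by simp
    from this[of 1] this[of 2] have "s = k * p" "t = k * q" by (simp_all add: defs)
    then have ps: "p * s + q * t = k * (p\<^sup>2 + q\<^sup>2)" and "s\<^sup>2 + t\<^sup>2 = k * (k * (p\<^sup>2 + q\<^sup>2))"
      by (simp_all add: power2_eq_square algebra_simps)
    then have "p\<^sup>2 + q\<^sup>2 = k * (k * (p\<^sup>2 + q\<^sup>2))"
      using that(2) by linarith
    also have "\<dots> = 0"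
      unfolding ps[symmetric] that(1) by simp
    finally have "p\<^sup>2 + q\<^sup>2 = 0" .
    with pq show False by (simp add: sum_power2_eq_zero_iff)
  qed
  have "?R \<longleftrightarrow> (s = - q \<and> t = p) \<or> (s = q \<and> t = - p)"
    using False by (auto simp: to_complex_def turn_def complex_eq_iff defs)
  moreover have "?L \<longleftrightarrow> p * s + q * t = 0 \<and> p\<^sup>2 + q\<^sup>2 = s\<^sup>2 + t\<^sup>2"
    using o d c by blast
  ultimately show ?thesis using right_isosceles_iff[OF pq, of s t] by simp
qed auto

lemma isosceles_right_triangle_iff:
  "isosceles_right_triangle T \<longleftrightarrow> turn_triangle (to_complex ` T)"
proof
  assume "isosceles_right_triangle T"
  then obtain a b c where T: "T = {a, b, c}" and "\<not> collinear {a, b, c}"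
      "orthogonal (b - a) (c - a)" "dist a b = dist a c"
    by (auto simp: isosceles_right_triangle_def)
  then have *: "a \<noteq> b" "to_complex c = turn (to_complex a) (to_complex b) \<or> to_complex b = turn (to_complex a) (to_complex c)"
    using isosceles_right_iff[of a b c] by auto
  from *(2) show "turn_triangle (to_complex ` T)"
  proof
    assume "to_complex c = turn (to_complex a) (to_complex b)"
    then have "to_complex ` T = {to_complex a, to_complex b, turn (to_complex a) (to_complex b)}"
      by (simp add: T)
    moreover have "to_complex a \<noteq> to_complex b" using *(1) by simp
    ultimately show ?thesis unfolding turn_triangle_def by blast
  next
    assume b: "to_complex b = turn (to_complex a) (to_complex c)"
    then have "to_complex ` T = {to_complex a, to_complex c, turn (to_complex a) (to_complex c)}"
      by (simp add: T insert_commute)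
    moreover have "to_complex a \<noteq> to_complex c" using *(1) b by auto
    ultimately show ?thesis unfolding turn_triangle_def by blast
  qed
next
  assume "turn_triangle (to_complex ` T)"
  then obtain x y where xy: "x \<noteq> y" "to_complex ` T = {x, y, turn x y}"
    unfolding turn_triangle_def by blast
  obtain a where a: "to_complex a = x" using to_complex_surj[of x] by blast
  obtain b where b: "to_complex b = y" using to_complex_surj[of y] by blast
  obtain c where c: "to_complex c = turn x y" using to_complex_surj[of "turn x y"] by blast
  note abc = a b c
  have "inj to_complex" by (simp add: inj_def)
  moreover have "to_complex ` T = to_complex ` {a, b, c}" using abc xy by simp
  ultimately have "T = {a, b, c}" by (simp only: inj_image_eq_iff)
  then show "isosceles_right_triangle T"
    using isosceles_right_iff[of a b c] abc xy(1) unfolding isosceles_right_triangle_def by metis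
qed

lemma S_tri_of_eq_num_tri: "S_tri_of P = num_tri (to_complex ` P)"
proof -
  have inj: "inj to_complex" by (simp add: inj_def)
  have "(`) to_complex ` {T. T \<subseteq> P \<and> isosceles_right_triangle T} =
      {T. T \<subseteq> to_complex ` P \<and> turn_triangle T}"
    by (auto simp: isosceles_right_triangle_iff image_iff subset_image_iff)
  moreover have "inj_on ((`) to_complex) {T. T \<subseteq> P \<and> isosceles_right_triangle T}"
    using inj by (simp add: inj_on_def inj_image_eq_iff)
  ultimately show ?thesis
    using card_image[of "(`) to_complex" "{T. T \<subseteq> P \<and> isosceles_right_triangle T}"]
    by (simp add: S_tri_of_def num_tri_eq_card_triangles)
qed

lemma S_tri_eqI:
  assumes "\<And>P. card P = n \<Longrightarrow> finite P \<Longrightarrow> num_tri P \<le> m" "\<exists>P. finite P \<and> card P = n \<and> num_tri P = m"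
  shows "S_tri n = m"
  unfolding S_tri_def
proof (rule Max_eqI)
  show "finite {S_tri_of P | P. finite P \<and> card P = n}"
    by (rule finite_S_tri_values)
next
  fix y assume "y \<in> {S_tri_of P | P. finite P \<and> card P = n}"
  then obtain P where "finite P" "card P = n" "y = num_tri (to_complex ` P)"
    by (auto simp: S_tri_of_eq_num_tri)
  moreover have "card (to_complex ` P) = card P"
    by (intro card_image) (simp add: inj_on_def)
  ultimately show "y \<le> m" using assms(1) by simp
next
  from assms(2) obtain Q where Q: "finite Q" "card Q = n" "num_tri Q = m" by blast
  define P where "P = to_complex -` Q"
  have inj: "inj to_complex" by (simp add: inj_def)
  have im: "to_complex ` P = Q"
    unfolding P_def using to_complex_surj by (auto simp: image_iff) metis
  have "finite P" unfolding P_def using inj Q by (intro finite_vimageI)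
  moreover have "card P = n"
    using Q im card_image[of to_complex P] inj by (simp add: inj_on_def)
  ultimately show "m \<in> {S_tri_of P | P. finite P \<and> card P = n}"
    using im Q by (auto simp: S_tri_of_eq_num_tri)
qed

subsection \<open>Configurations of Gaussian integers\<close>

text \<open>Unlike \<^const>\<open>list_ex\<close>, this search stops at the first hit when it is evaluated by
  rewriting.\<close>

fun any :: "('a \<Rightarrow> bool) \<Rightarrow> 'a list \<Rightarrow> bool" where
  "any f [] = False"
| "any f (x # xs) = (if f x then True else any f xs)"

lemma any_iff [simp]: "any f xs \<longleftrightarrow> (\<exists>x\<in>set xs. f x)"
  by (induction xs) auto

type_synonym gauss = "int \<times> int"

fun emb :: "gauss \<Rightarrow> complex" where
  "emb (x, y) = Complex (of_int x) (of_int y)"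

fun gadd :: "gauss \<Rightarrow> gauss \<Rightarrow> gauss" where
  "gadd (a, b) (c, d) = (a + c, b + d)"

fun gsub :: "gauss \<Rightarrow> gauss \<Rightarrow> gauss" where
  "gsub (a, b) (c, d) = (a - c, b - d)"

fun gmult :: "gauss \<Rightarrow> gauss \<Rightarrow> gauss" where
  "gmult (a, b) (c, d) = (a * c - b * d, a * d + b * c)"

fun gturn :: "gauss \<Rightarrow> gauss \<Rightarrow> gauss" where
  "gturn (a, b) (c, d) = (a - (d - b), b + (c - a))"

fun gturn' :: "gauss \<Rightarrow> gauss \<Rightarrow> gauss" where
  "gturn' (a, b) (c, d) = (a + (d - b), b - (c - a))"

lemma emb_eq_iff [simp]: "emb p = emb q \<longleftrightarrow> p = q"
  by (cases p; cases q) auto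

lemma emb_arith:
  "emb (gadd p q) = emb p + emb q" "emb (gsub p q) = emb p - emb q"
  "emb (gmult p q) = emb p * emb q"
  "emb (gturn p q) = turn (emb p) (emb q)" "emb (gturn' p q) = turn' (emb p) (emb q)"
  by (cases p; cases q; simp add: complex_eq_iff turn_def turn'_def)+

section \<open>Counting triangles in a list of Gaussian integers\<close>

definition hit :: "gauss list \<Rightarrow> gauss \<Rightarrow> int" where
  "hit D q = (if any ((=) q) D then 1 else 0)"

text \<open>The recursion runs over the last argument while membership is tested in the fixed list
  \<open>D\<close>. With \<open>D\<close> in both places and \<open>q\<close> outside it, this is
  the number of triangles that \<open>q\<close> adds, split as in
  \<open>num_tri_insert\<close>.\<close>

fun degree_over :: "gauss list \<Rightarrow> gauss \<Rightarrow> gauss list \<Rightarrow> int" where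
  "degree_over D q [] = 0"
| "degree_over D q (b # bs) =
     hit D (gturn q b) + hit D (gturn b q) + hit D (gturn' b q) + degree_over D q bs"

fun triangles :: "gauss list \<Rightarrow> int" where
  "triangles [] = 0"
| "triangles (q # D) = degree_over D q D + triangles D"

lemma card_Collect_insert:
  assumes "finite A" "x \<notin> A"
  shows "card {b \<in> insert x A. Q b} = of_bool (Q x) + card {b \<in> A. Q b}"
proof -
  have "{b \<in> insert x A. Q b} = (if Q x then insert x {b \<in> A. Q b} else {b \<in> A. Q b})"
    by auto
  then show ?thesis using assms by simp
qed

lemma degree_over_eq:
  "distinct bs \<Longrightarrow> degree_over D q bs = int (card {b \<in> set bs. gturn q b \<in> set D}
     + card {a \<in> set bs. gturn a q \<in> set D} + card {a \<in> set bs. gturn' a q \<in> set D})"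
  by (induction bs) (simp_all add: card_Collect_insert hit_def del: insert_iff)

text \<open>Similarities of the form \<open>x + d * c\<close> commute with both quarter turns, so
  counts in the complex plane are computed on integer lists.\<close>

lemma num_tri_similar:
  assumes "d \<noteq> 0" "distinct D"
  shows "int (num_tri ((\<lambda>c. x + d * emb c) ` set D)) = triangles D"
  using \<open>distinct D\<close>
proof (induction D)
  case Nil
  then show ?case by (simp add: num_tri_def legs_def)
next
  case (Cons q D)
  define f where "f c = x + d * emb c" for c
  have inj: "f a = f b \<longleftrightarrow> a = b" for a b
    using \<open>d \<noteq> 0\<close> by (simp add: f_def)
  have mem: "f a \<in> f ` A \<longleftrightarrow> a \<in> A" for a A
    by (rule inj_image_mem_iff) (simp add: inj_def inj del: split_paired_All)
  have turns: "turn (f a) (f b) = f (gturn a b)" "turn' (f a) (f b) = f (gturn' a b)" for a b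
    by (simp_all add: f_def emb_arith) (simp_all add: turn_def turn'_def algebra_simps)
  have card: "card {b \<in> f ` set D. Q b} = card {b \<in> set D. Q (f b)}" for Q
  proof -
    have "{b \<in> f ` set D. Q b} = f ` {b \<in> set D. Q (f b)}" by auto
    then show ?thesis using inj by (simp add: card_image inj_on_def)
  qed
  have "num_tri (f ` set (q # D)) = num_tri (f ` set D) + card {b \<in> set D. gturn q b \<in> set D}
      + card {a \<in> set D. gturn a q \<in> set D} + card {a \<in> set D. gturn' a q \<in> set D}"
    using Cons.prems by (simp add: num_tri_insert mem card turns)
  then show ?case
    using Cons degree_over_eq[of D D q] by (simp flip: f_def)
qed

text \<open>A list \<open>C\<close> stands for the configuration consisting of \<open>0\<close>, \<open>1\<close> and the
  Gaussian integers in \<open>C\<close>.\<close>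

definition base :: "gauss list \<Rightarrow> gauss list" where
  "base C = (0, 0) # (1, 0) # C"

definition realises :: "complex set \<Rightarrow> gauss list \<Rightarrow> bool" where
  "realises P C \<longleftrightarrow> (\<exists>x d. d \<noteq> 0 \<and> P = (\<lambda>c. x + d * emb c) ` set (base C))"

definition well_formed :: "nat \<Rightarrow> int \<Rightarrow> gauss list \<Rightarrow> bool" where
  "well_formed n m C \<longleftrightarrow> distinct (base C) \<and> length (base C) = n \<and> triangles (base C) \<le> m"

text \<open>The third vertices of the isosceles right triangles on two given points, in coordinates scaled
  by 2, since the right-angle vertex over a hypotenuse may be half-integral.\<close>

fun apexes_from :: "gauss \<Rightarrow> gauss list \<Rightarrow> gauss list \<Rightarrow> gauss list" where
  "apexes_from a [] A = A"
| "apexes_from a (b # bs) A = apexes_from a bs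
     (List.insert (gmult (2, 0) (gturn a b)) (List.insert (gmult (2, 0) (gturn' a b))
       (List.insert (gadd (gturn a b) b) A)))"

fun apexes :: "gauss list \<Rightarrow> gauss list \<Rightarrow> gauss list" where
  "apexes [] C = []"
| "apexes (a # as) C = apexes_from a C (apexes as C)"

lemma set_apexes_from: "set (apexes_from a C A) = set A \<union>
    (\<Union>b\<in>set C. {gmult (2, 0) (gturn a b), gmult (2, 0) (gturn' a b), gadd (gturn a b) b})"
  by (induction a C A rule: apexes_from.induct) auto

lemma set_apexes: "set (apexes B C) = (\<Union>a\<in>set B. \<Union>b\<in>set C.
    {gmult (2, 0) (gturn a b), gmult (2, 0) (gturn' a b), gadd (gturn a b) b})"
  by (induction B C rule: apexes.induct) (auto simp: set_apexes_from)

text \<open>\<open>X\<close> is matched with a listed configuration by trying all pairs of its points as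
  the images of \<open>0\<close> and \<open>1\<close>; equality of the triangle counts is only a filter that saves
  most of these trials.\<close>

definition misses :: "gauss list \<Rightarrow> gauss \<Rightarrow> gauss \<Rightarrow> gauss \<Rightarrow> bool" where
  "misses X x d c \<longleftrightarrow> \<not> any ((=) (gadd x (gmult d c))) X"

definition fits_at :: "gauss list \<Rightarrow> gauss list \<Rightarrow> gauss \<Rightarrow> gauss \<Rightarrow> bool" where
  "fits_at X C x y = (if x = y then False else \<not> any (misses X x (gsub y x)) C)"

definition fits_from :: "gauss list \<Rightarrow> gauss list \<Rightarrow> gauss \<Rightarrow> bool" where
  "fits_from X C x = any (fits_at X C x) X"

definition fits :: "gauss list \<Rightarrow> int \<Rightarrow> int \<times> gauss list \<Rightarrow> bool" where
  "fits X s kC = (if fst kC = s then any (fits_from X (snd kC)) X else False)"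

definition annotate :: "gauss list \<Rightarrow> int \<times> gauss list" where
  "annotate C = (triangles (base C), C)"

definition total_ok :: "int \<Rightarrow> (int \<times> gauss list) list \<Rightarrow> gauss list \<Rightarrow> int \<Rightarrow> bool" where
  "total_ok t Ls X s = (if s < t then True else any (fits X s) Ls)"

definition apex_ok :: "int \<Rightarrow> (int \<times> gauss list) list \<Rightarrow> gauss list \<Rightarrow> int \<Rightarrow> gauss \<Rightarrow> bool" where
  "apex_ok t Ls D s q =
    (if any ((=) q) D then True else total_ok t Ls (q # D) (s + degree_over D q D))"

text \<open>Multiplication by 2 brings the configuration to the scale of its apexes and keeps its
  count, which is therefore taken from \<open>C\<close> itself.\<close>

definition config_ok :: "int \<Rightarrow> (int \<times> gauss list) list \<Rightarrow> gauss list \<Rightarrow> bool" where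
  "config_ok t Ls C \<longleftrightarrow>
     list_all (apex_ok t Ls (map (gmult (2, 0)) C) (triangles C)) (apexes C C)"

text \<open>One level of the search: an apex outside a configuration of \<open>Ls\<close> either
  leaves the count below \<open>t\<close> or yields a set that contains a similar copy of a
  configuration in \<open>Ls'\<close> with the same count.\<close>

definition extends_to :: "int \<Rightarrow> gauss list list \<Rightarrow> gauss list list \<Rightarrow> bool" where
  "extends_to t Ls Ls' \<longleftrightarrow> list_all (config_ok t (map annotate Ls')) (map base Ls)"

lemma realises_num_tri:
  assumes "realises P C" "well_formed n m C"
  shows "int (num_tri P) = triangles (base C)" "card P = n" "int (num_tri P) \<le> m"
proof -
  from assms obtain x d where *: "d \<noteq> 0" "P = (\<lambda>c. x + d * emb c) ` set (base C)"
      and wf: "distinct (base C)" "length (base C) = n" "triangles (base C) \<le> m"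
    by (auto simp: realises_def well_formed_def)
  show cnt: "int (num_tri P) = triangles (base C)"
    using num_tri_similar[OF *(1) wf(1)] *(2) by simp
  have "inj_on (\<lambda>c. x + d * emb c) (set (base C))"
    using *(1) by (auto simp: inj_on_def)
  then show "card P = n"
    using * wf by (simp add: card_image distinct_card)
  show "int (num_tri P) \<le> m" using cnt wf by simp
qed

text \<open>Soundness of the search: since \<open>p\<close> forms a triangle with two points of
  \<open>P\<close>, it is one of the apexes examined.\<close>

lemma extends_toD:
  assumes ext: "extends_to t Ls Ls'"
    and wf: "list_all (well_formed n m) Ls" "list_all (well_formed (Suc n) m') Ls'"
    and C: "C \<in> set Ls" "realises P C"
    and p: "p \<notin> P" "num_tri P < num_tri (insert p P)" "t \<le> int (num_tri (insert p P))"
  shows "\<exists>C'\<in>set Ls'. realises (insert p P) C'"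
proof -
  from wf(1) C(1) have wfC: "well_formed n m C"
    by (simp add: list_all_iff)
  then have dist: "distinct (base C)" by (simp add: well_formed_def)
  from C(2) obtain x d where d: "d \<noteq> 0" and P: "P = (\<lambda>c. x + d * emb c) ` set (base C)"
    by (auto simp: realises_def)
  have "finite P" using P by simp
  \<comment> \<open>The factor \<open>d / 2\<close> undoes the doubling of coordinates in
    \<open>apexes\<close>.\<close>
  define g where "g c = x + d / 2 * emb c" for c
  have g_inj: "g a = g b \<longleftrightarrow> a = b" for a b
    using d by (simp add: g_def)
  define D where "D = map (gmult (2, 0)) (base C)"
  have emb2: "Complex 2 0 = 2" by (simp add: complex_eq_iff)
  have g2: "x + d * emb c = g (gmult (2, 0) c)" for c
    by (simp add: g_def emb_arith emb2)
  have PD: "P = g ` set D"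
    by (simp add: P D_def g2 image_image)
  have gturns: "g (gmult (2, 0) (gturn a b)) = turn (x + d * emb a) (x + d * emb b)"
      "g (gmult (2, 0) (gturn' a b)) = turn' (x + d * emb a) (x + d * emb b)"
      "turn (g (gadd (gturn a b) b)) (x + d * emb a) = x + d * emb b" for a b
    by (simp_all add: g_def emb_arith emb2 turn_def turn'_def algebra_simps complex_eq_iff)
  obtain q where q: "q \<in> set (apexes (base C) (base C))" "p = g q"
  proof -
    \<comment> \<open>The point \<open>p\<close> occurs in a new triangle in one of three roles;
      each role expresses it as one of the three kinds of apex over two points of
      \<open>P\<close>.\<close>
    have "card {b \<in> P. turn p b \<in> P} \<noteq> 0 \<or> card {a \<in> P. turn a p \<in> P} \<noteq> 0 \<or>
        card {a \<in> P. turn' a p \<in> P} \<noteq> 0"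
      using p(2) num_tri_insert[OF \<open>finite P\<close> p(1)] by linarith
    then consider b where "b \<in> P" "turn p b \<in> P" | a where "a \<in> P" "turn a p \<in> P"
      | a where "a \<in> P" "turn' a p \<in> P"
      using \<open>finite P\<close> by auto
    then show thesis
    proof cases
      case 1
      then obtain u v where uv: "u \<in> set (base C)" "v \<in> set (base C)"
          "b = x + d * emb v" "turn p b = x + d * emb u"
        unfolding P by auto
      have "p = g (gadd (gturn v u) u)"
      proof -
        \<comment> \<open>The coefficient of the centre in \<open>turn y b\<close> is 1 - i, which
          is nonzero, so the centre is determined by a point and its image.\<close>
        have eq: "y = z" if "turn y b = turn z b" for y z
        proof -
          have "(1 - \<i>) * (y - z) = 0" using that by (simp add: turn_def algebra_simps)
          moreover have "1 - \<i> \<noteq> 0" by (simp add: complex_eq_iff)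
          ultimately show ?thesis by simp
        qed
        show ?thesis
          by (rule eq) (use uv gturns(3)[of v u] in simp)
      qed
      then show thesis using uv by (intro that) (auto simp: set_apexes)
    next
      case 2
      then obtain u v where uv: "u \<in> set (base C)" "v \<in> set (base C)"
          "a = x + d * emb u" "turn a p = x + d * emb v"
        unfolding P by auto
      then have "p = g (gmult (2, 0) (gturn' u v))"
        by (metis gturns(2) turn_simps(2))
      then show thesis using uv by (intro that) (auto simp: set_apexes)
    next
      case 3
      then obtain u v where uv: "u \<in> set (base C)" "v \<in> set (base C)"
          "a = x + d * emb u" "turn' a p = x + d * emb v"
        unfolding P by auto
      then have "p = g (gmult (2, 0) (gturn u v))"
        by (metis gturns(1) turn_simps(1))
      then show thesis using uv by (intro that) (auto simp: set_apexes)
    qed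
  qed
  have distD: "distinct D"
    unfolding D_def distinct_map using dist by (auto simp: inj_on_def)
  have "q \<notin> set D" using p(1) q PD by auto
  define X where "X = q # D"
  have distX: "distinct X" using distD \<open>q \<notin> set D\<close> by (simp add: X_def)
  have PX: "insert p P = g ` set X" by (simp add: X_def q PD)
  have "triangles X = int (num_tri (insert p P))"
    using num_tri_similar[of "d / 2" X x] distX d by (simp add: PX g_def)
  moreover have "triangles D = int (num_tri P)"
    using num_tri_similar[of "d / 2" D x] distD d by (simp add: PD g_def)
  moreover have "int (num_tri P) = triangles (base C)"
    using realises_num_tri[OF C(2) wfC] by simp
  ultimately have tX: "triangles (base C) + degree_over D q D = int (num_tri (insert p P))"
    by (simp add: X_def)
  from ext C(1) q(1) have "apex_ok t (map annotate Ls') D (triangles (base C)) q"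
    by (auto simp: extends_to_def config_ok_def list_all_iff D_def)
  then have "total_ok t (map annotate Ls') X (int (num_tri (insert p P)))"
    using \<open>q \<notin> set D\<close> tX by (simp add: apex_ok_def X_def)
  then obtain C' where C': "C' \<in> set Ls'" "any (fits_from X C') X"
    using p(3) by (auto simp: total_ok_def fits_def annotate_def split: if_splits)
  then obtain u v where uv: "u \<in> set X" "v \<in> set X" "u \<noteq> v"
      and fit: "\<forall>c\<in>set C'. gadd u (gmult (gsub v u) c) \<in> set X"
    by (auto simp: fits_from_def fits_at_def misses_def split: if_splits)
  from wf(2) C'(1) have wf': "distinct (base C')" "length (base C') = Suc n"
    by (auto simp: list_all_iff well_formed_def)
  define h where "h c = g u + (g v - g u) * emb c" for c
  have h: "h c = g (gadd u (gmult (gsub v u) c))" for c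
    by (simp add: h_def g_def emb_arith algebra_simps)
  have "h (0, 0) = g u" "h (1, 0) = g v"
    by (simp_all add: h_def complex_eq_iff)
  then have sub: "h ` set (base C') \<subseteq> insert p P"
    using uv fit by (auto simp: base_def PX h simp del: emb.simps)
  have "g v - g u \<noteq> 0" using uv g_inj by auto
  then have "inj_on h (set (base C'))"
    by (auto simp: inj_on_def h_def)
  then have "card (h ` set (base C')) = Suc n"
    using wf' by (simp add: card_image distinct_card)
  also have "Suc n = card (insert p P)"
    using realises_num_tri[OF C(2) wfC] \<open>finite P\<close> p(1) by simp
  \<comment> \<open>The matching test only gives an inclusion; equal cardinality turns it into
    equality.\<close>
  finally have "insert p P = h ` set (base C')"
    using sub \<open>finite P\<close> by (metis card_subset_eq finite_insert)
  then show ?thesis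
    using C'(1) \<open>g v - g u \<noteq> 0\<close> unfolding realises_def h_def by blast
qed

subsection \<open>The configurations with many triangles\<close>

text \<open>The lists for 4, 5, 6, 7 and 8 points serve the thresholds 2, 4, 8, 13 and 20: up to
  similarity they cover all sets with at least that many triangles, on 5 and 6 points provided that
  every point lies in a triangle.\<close>

definition configs3 :: "gauss list list" where
  "configs3 = [
    [(0,1)]]"

definition configs4 :: "gauss list list" where
  "configs4 = [
    [(1,-1),(0,-1)],
    [(0,-1),(-1,0)],
    [(0,-1),(-1,-1)],
    [(1,1),(-1,1)],
    [(0,1),(-1,1)],
    [(1,-1),(-1,-1)]]"

definition configs5 :: "gauss list list" where
  "configs5 = [
    [(0,1),(0,-1),(-1,0)],
    [(0,-1),(-1,0),(-1,-1)],
    [(0,1),(-1,1),(-1,0)],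
    [(-1,-2),(0,-1),(-1,0)],
    [(1,-2),(0,-1),(-1,0)],
    [(0,-2),(1,-1),(-1,-1)],
    [(0,1),(0,-1),(-1,-1)],
    [(1,1),(-1,1),(-1,-1)],
    [(0,1),(-1,0),(-1,-1)],
    [(1,-1),(-1,1),(-1,-1)],
    [(-2,-1),(0,-1),(-1,0)],
    [(-1,2),(0,-1),(-1,0)],
    [(1,2),(0,-1),(-1,0)],
    [(2,-1),(0,-1),(-1,0)]]"

definition configs6 :: "gauss list list" where
  "configs6 = [
    [(0,1),(0,-1),(-1,0),(-1,-1)],
    [(1,1),(1,-1),(-1,1),(-1,-1)],
    [(-2,-1),(0,1),(0,-1),(-1,0)],
    [(-2,1),(0,1),(0,-1),(-1,0)],
    [(1,-1),(0,-1),(-1,0),(-1,-1)],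
    [(-1,-2),(0,-1),(-1,0),(-1,-1)],
    [(0,-1),(-1,1),(-1,0),(-1,-1)],
    [(-2,0),(0,-1),(-1,0),(-1,-1)],
    [(0,2),(1,1),(-1,1),(-1,-1)],
    [(0,-2),(1,1),(1,-1),(-1,-1)],
    [(-2,-1),(0,-1),(-1,0),(-1,-1)],
    [(1,-2),(0,-1),(-1,0),(-1,-1)],
    [(1,1),(0,1),(-1,1),(-1,-1)],
    [(2,0),(0,-2),(1,-1),(-1,-1)],
    [(0,1),(-1,1),(-1,0),(-1,-1)],
    [(0,-2),(1,-1),(-1,1),(-1,-1)],
    [(-2,1),(0,1),(-1,1),(-1,0)]]"

definition configs7 :: "gauss list list" where
  "configs7 = [
    [(0,1),(0,-1),(-1,1),(-1,0),(-1,-1)],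
    [(-2,1),(-2,-1),(0,1),(0,-1),(-1,0)],
    [(0,2),(1,1),(1,-1),(-1,1),(-1,-1)],
    [(0,-2),(1,1),(1,-1),(-1,1),(-1,-1)],
    [(1,1),(0,1),(0,-1),(-1,0),(-1,-1)],
    [(-2,-1),(0,1),(0,-1),(-1,0),(-1,-1)],
    [(-1,-2),(0,1),(0,-1),(-1,0),(-1,-1)],
    [(1,-2),(0,1),(0,-1),(-1,0),(-1,-1)],
    [(-2,1),(0,1),(0,-1),(-1,0),(-1,-1)],
    [(1,1),(1,-1),(0,-1),(-1,1),(-1,-1)],
    [(-1,-2),(-2,-1),(0,1),(0,-1),(-1,0)],
    [(0,-2),(0,1),(0,-1),(-1,0),(-1,-1)],
    [(-2,0),(0,1),(0,-1),(-1,0),(-1,-1)],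
    [(-2,0),(1,1),(1,-1),(-1,1),(-1,-1)],
    [(-1,2),(0,1),(0,-1),(-1,0),(-1,-1)],
    [(1,2),(0,1),(0,-1),(-1,0),(-1,-1)],
    [(2,-1),(0,1),(0,-1),(-1,0),(-1,-1)],
    [(2,1),(0,1),(0,-1),(-1,0),(-1,-1)],
    [(-1,2),(-2,-1),(0,1),(0,-1),(-1,0)],
    [(2,-1),(-2,-1),(0,1),(0,-1),(-1,0)],
    [(-1,-2),(-2,1),(0,1),(0,-1),(-1,0)],
    [(1,-1),(0,-1),(-1,1),(-1,0),(-1,-1)],
    [(1,1),(0,1),(-1,1),(-1,0),(-1,-1)]]"

definition configs8 :: "gauss list list" where
  "configs8 = [
    [(1,-1),(0,1),(0,-1),(-1,1),(-1,0),(-1,-1)],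
    [(-2,0),(0,1),(0,-1),(-1,1),(-1,0),(-1,-1)],
    [(2,0),(0,-2),(1,1),(1,-1),(-1,1),(-1,-1)],
    [(2,0),(0,2),(1,1),(1,-1),(-1,1),(-1,-1)],
    [(-2,1),(-2,-1),(0,1),(0,-1),(-1,0),(-1,-1)],
    [(1,-2),(-1,-2),(0,1),(0,-1),(-1,0),(-1,-1)],
    [(-1,-2),(-2,-1),(0,1),(0,-1),(-1,0),(-1,-1)]]"

text \<open>In this check and its analogues the number bounding the triangles is the claimed
  maximum, so matching a list yields the upper bound.\<close>

lemma well_formed3: "list_all (well_formed 3 1) configs3"
  by code_simp

lemma well_formed4: "list_all (well_formed 4 4) configs4"
  by code_simp

lemma well_formed5: "list_all (well_formed 5 8) configs5"
  by code_simp

lemma well_formed6: "list_all (well_formed 6 11) configs6"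
  by code_simp

lemma well_formed7: "list_all (well_formed 7 15) configs7"
  by code_simp

lemma well_formed8: "list_all (well_formed 8 20) configs8"
  by code_simp

lemma extends3: "extends_to 2 configs3 configs4"
  by code_simp

lemma extends4: "extends_to 4 configs4 configs5"
  by code_simp

lemma extends5: "extends_to 8 configs5 configs6"
  by code_simp

lemma extends6: "extends_to 13 configs6 configs7"
  by code_simp

lemma extends7: "extends_to 20 configs7 configs8"
  by code_simp

text \<open>The target list is empty: no apex added to a listed configuration of 8 points reaches 29
  triangles.\<close>

lemma extends8: "extends_to 29 configs8 []"
  by code_simp

subsection \<open>Upper bounds by removal of a point of low degree\<close>

text \<open>If neither \<open>p\<close> nor \<open>r\<close> forms a triangle with two points of \<open>K\<close>, then a new triangle
  consists of \<open>p\<close>, \<open>r\<close> and one of the six points completing these two. So if there are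
  \<open>card K\<close> new triangles, then \<open>K\<close> lies in that six-point set, which has two triangles.\<close>

lemma isolated_points_bound:
  assumes K: "finite K" "p \<notin> K" "r \<notin> K" "p \<noteq> r"
    and iso: "num_tri (insert r K) = num_tri K" "num_tri (insert p K) = num_tri K"
    and le: "num_tri K + card K \<le> num_tri (insert p (insert r K))"
  shows "num_tri K \<le> 2"
proof -
  \<comment> \<open>Coordinates with \<open>p\<close> at 0 and \<open>r\<close> at 2 make all six
    completing points Gaussian: right angle at \<open>p\<close> for (0, 2) and (0, -2), at
    \<open>r\<close> for (2, 2) and (2, -2), and hypotenuse from \<open>p\<close> to
    \<open>r\<close> for (1, 1) and (1, -1).\<close>
  define g where "g c = p + (r - p) / 2 * emb c" for c
  define A :: "gauss list" where "A = [(0,2), (0,-2), (1,1), (1,-1), (2,2), (2,-2)]"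
  have g_inj: "g a = g b \<longleftrightarrow> a = b" for a b
    using K(4) by (simp add: g_def)
  have A: "distinct A" "triangles A = 2"
    unfolding A_def by code_simp+
  have g_eqs: "turn p r = g (0,2)" "turn' p r = g (0,-2)" "turn r p = g (2,-2)" "turn' r p = g (2,2)"
    by (simp_all add: g_def turn_def turn'_def complex_eq_iff field_simps)
  have mid: "a = g (1,1)" if "turn a p = r" for a
  proof -
    have "(1 - \<i>) * (a - g (1,1)) = 0"
      using that by (auto simp: g_def turn_def complex_eq_iff field_simps)
    moreover have "1 - \<i> \<noteq> 0" by (simp add: complex_eq_iff)
    ultimately show ?thesis by simp
  qed
  have mid': "a = g (1,-1)" if "turn' a p = r" for a
  proof -
    have "(1 + \<i>) * (a - g (1,-1)) = 0"
      using that by (auto simp: g_def turn'_def complex_eq_iff field_simps)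
    moreover have "1 + \<i> \<noteq> 0" by (simp add: complex_eq_iff)
    ultimately show ?thesis by simp
  qed
  have "card {b \<in> K. turn p b \<in> K} + card {a \<in> K. turn a p \<in> K} + card {a \<in> K. turn' a p \<in> K} = 0"
    using num_tri_insert[of K p] K iso(2) by linarith
  then have no: "\<And>b. b \<in> K \<Longrightarrow> turn p b \<notin> K" "\<And>a. a \<in> K \<Longrightarrow> turn a p \<notin> K"
      "\<And>a. a \<in> K \<Longrightarrow> turn' a p \<notin> K"
    using K(1) by auto
  \<comment> \<open>Used once for each role of \<open>p\<close>: either the counted vertex is
    \<open>r\<close> and the third vertex is \<open>y\<close>, or the counted vertex is
    \<open>z\<close> and the third is \<open>r\<close>.\<close>
  have bound: "card S \<le> of_bool (y \<in> K) + of_bool (z \<in> K)"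
    if "S \<subseteq> (if y \<in> K then {r} else {}) \<union> (if z \<in> K then {z} else {})" for S y z
    using card_mono[OF _ that] by (auto simp: card_insert_if split: if_splits)
  let ?D = "insert r K"
  have "card {b \<in> ?D. turn p b \<in> ?D} \<le> of_bool (g (0,2) \<in> K) + of_bool (g (0,-2) \<in> K)"
  proof (rule bound, rule subsetI)
    fix b assume b: "b \<in> {b \<in> ?D. turn p b \<in> ?D}"
    show "b \<in> (if g (0,2) \<in> K then {r} else {}) \<union> (if g (0,-2) \<in> K then {g (0,-2)} else {})"
    proof (cases "b = r")
      case True
      then show ?thesis using b K by (auto simp flip: g_eqs)
    next
      case False
      then have "turn p b = r" "b \<in> K" using b no(1)[of b] by auto
      then have "b = turn' p r" by auto
      then show ?thesis using \<open>b \<in> K\<close> g_eqs by auto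
    qed
  qed
  moreover have "card {a \<in> ?D. turn a p \<in> ?D} \<le> of_bool (g (2,-2) \<in> K) + of_bool (g (1,1) \<in> K)"
  proof (rule bound, rule subsetI)
    fix a assume a: "a \<in> {a \<in> ?D. turn a p \<in> ?D}"
    show "a \<in> (if g (2,-2) \<in> K then {r} else {}) \<union> (if g (1,1) \<in> K then {g (1,1)} else {})"
    proof (cases "a = r")
      case True
      then show ?thesis using a K by (auto simp flip: g_eqs)
    next
      case False
      then have "turn a p = r" "a \<in> K" using a no(2)[of a] by auto
      then show ?thesis using mid by auto
    qed
  qed
  moreover have "card {a \<in> ?D. turn' a p \<in> ?D} \<le> of_bool (g (2,2) \<in> K) + of_bool (g (1,-1) \<in> K)"
  proof (rule bound, rule subsetI)
    fix a assume a: "a \<in> {a \<in> ?D. turn' a p \<in> ?D}"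
    show "a \<in> (if g (2,2) \<in> K then {r} else {}) \<union> (if g (1,-1) \<in> K then {g (1,-1)} else {})"
    proof (cases "a = r")
      case True
      then show ?thesis using a K by (auto simp flip: g_eqs)
    next
      case False
      then have "turn' a p = r" "a \<in> K" using a no(3)[of a] by auto
      then show ?thesis using mid' by auto
    qed
  qed
  moreover have "num_tri (insert p ?D) = num_tri ?D + card {b \<in> ?D. turn p b \<in> ?D}
      + card {a \<in> ?D. turn a p \<in> ?D} + card {a \<in> ?D. turn' a p \<in> ?D}"
    using K by (intro num_tri_insert) auto
  moreover have "card {q \<in> set A. g q \<in> K} = of_bool (g (0,2) \<in> K) + of_bool (g (0,-2) \<in> K)
      + of_bool (g (1,1) \<in> K) + of_bool (g (1,-1) \<in> K) + of_bool (g (2,2) \<in> K) + of_bool (g (2,-2) \<in> K)"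
    unfolding A_def list.set
    by (subst card_Collect_insert, simp, simp)+ simp
  \<comment> \<open>Across the three bounds each of the six points is counted once, so
    \<open>K\<close> has no more points than it shares with the six.\<close>
  ultimately have "card K \<le> card {q \<in> set A. g q \<in> K}"
    using le iso(1) by linarith
  also have "\<dots> = card (g ` {q \<in> set A. g q \<in> K})"
    using g_inj by (intro card_image[symmetric]) (auto simp: inj_on_def)
  finally have "g ` {q \<in> set A. g q \<in> K} = K"
    using K(1) by (intro card_seteq) auto
  then have "K \<subseteq> g ` set A" by auto
  then have "num_tri K \<le> num_tri (g ` set A)"
    by (intro num_tri_mono) auto
  also have "\<dots> = 2"
    using num_tri_similar[of "(r - p) / 2" A p] A K(4) by (simp add: g_def)
  finally show ?thesis .
qed

section \<open>Classification by adding one point at a time\<close>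

definition realises_one_of :: "complex set \<Rightarrow> gauss list list \<Rightarrow> bool" where
  "realises_one_of P Ls \<longleftrightarrow> (\<exists>C\<in>set Ls. realises P C)"

lemma similar_bound:
  assumes "realises_one_of P Ls" "list_all (well_formed n (int m)) Ls"
  shows "num_tri P \<le> m"
  using assms realises_num_tri(3)[of P _ n "int m"] by (fastforce simp: realises_one_of_def list_all_iff)

lemma similar_remove:
  assumes "extends_to (int t) Ls Ls'" "list_all (well_formed n m) Ls" 
    "list_all (well_formed (Suc n) m') Ls'"
    and "realises_one_of (P - {p}) Ls" "p \<in> P" "num_tri (P - {p}) < num_tri P" "t \<le> num_tri P"
  shows "realises_one_of P Ls'"
  using assms extends_toD[of "int t" Ls Ls' n m m' _ "P - {p}" p]
  by (auto simp: realises_one_of_def insert_absorb)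

text \<open>The search covers only points that create a triangle; the second alternative is the case
  of degree 0.\<close>

lemma similar_or_isolated:
  assumes "extends_to (int t) Ls Ls'" "list_all (well_formed n m) Ls"
    "list_all (well_formed (Suc n) m') Ls'"
    and "realises_one_of (P - {p}) Ls" "finite P" "p \<in> P" "t \<le> num_tri P"
  shows "realises_one_of P Ls' \<or> (\<exists>p\<in>P. num_tri (P - {p}) = num_tri P)"
proof (cases "num_tri (P - {p}) = num_tri P")
  case False
  moreover have "num_tri (P - {p}) \<le> num_tri P" using assms(5) by (intro num_tri_mono) auto
  ultimately show ?thesis using similar_remove[OF assms(1-4,6)] assms(7) by simp
qed (use assms(6) in blast)

lemma remove_point:
  assumes "card P = n" "n > 0"
  obtains p where "p \<in> P" "card (P - {p}) = n - 1" "n * num_tri P \<le> 3 * num_tri P + n * num_tri (P - {p})"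
proof -
  have "finite P" "P \<noteq> {}" using assms card_gt_0_iff by blast+
  then show thesis using exists_low_degree_point[of P] assms that by auto
qed

text \<open>The similarity sending 0 to \<open>a\<close> and 1 to \<open>b\<close> sends i to
  \<open>turn a b\<close>.\<close>

lemma similar3:
  assumes "card P = 3" "num_tri P \<ge> 1"
  shows "realises_one_of P configs3"
proof -
  have fin: "finite P" using assms card.infinite by fastforce
  have "legs P \<noteq> {}" using assms by (auto simp: num_tri_def)
  then obtain a b where ab: "a \<in> P" "b \<in> P" "a \<noteq> b" "turn a b \<in> P"
    by (auto simp: legs_def)
  then have "{a, b, turn a b} = P"
    using assms fin by (intro card_subset_eq) auto
  moreover have "emb (0, 0) = 0" "emb (1, 0) = 1" "emb (0, 1) = \<i>"
    by (simp_all add: complex_eq_iff)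
  ultimately have "P = (\<lambda>c. a + (b - a) * emb c) ` set (base [(0,1)])"
    by (auto simp: base_def turn_def algebra_simps simp del: emb.simps)
  then show ?thesis
    using ab(3) unfolding realises_one_of_def realises_def configs3_def
    by (metis list.set_intros(1) right_minus_eq)
qed

lemma num_tri_le_1: "card P = 3 \<Longrightarrow> num_tri P \<le> 1"
  using similar3[of P] similar_bound[of P configs3 3 1] well_formed3 by force

text \<open>Averaging leaves a triangle on three points. These carry at most one, so the removed
  point has positive degree.\<close>

lemma similar4:
  assumes "card P = 4" "num_tri P \<ge> 2"
  shows "realises_one_of P configs4"
proof -
  obtain p where p: "p \<in> P" "card (P - {p}) = 3" "4 * num_tri P \<le> 3 * num_tri P + 4 * num_tri (P - {p})"
    using remove_point[OF assms(1)] by auto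
  have "realises_one_of (P - {p}) configs3"
    using p assms by (intro similar3) auto
  then show ?thesis
    using similar_remove[of 2 configs3 configs4 3 1 4 P p] extends3 well_formed3 well_formed4
      num_tri_le_1[OF p(2)] p assms by simp
qed

lemma num_tri_le_4: "card P = 4 \<Longrightarrow> num_tri P \<le> 4"
  using similar4[of P] similar_bound[of P configs4 4 4] well_formed4 by force

text \<open>Four points can carry all 4 triangles, so the removed point may have degree 0.\<close>

lemma similar5_or_isolated:
  assumes "card P = 5" "num_tri P \<ge> 4"
  shows "realises_one_of P configs5 \<or> (\<exists>p\<in>P. num_tri (P - {p}) = num_tri P)"
proof -
  obtain p where p: "p \<in> P" "card (P - {p}) = 4" "5 * num_tri P \<le> 3 * num_tri P + 5 * num_tri (P - {p})"
    using remove_point[OF assms(1)] by auto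
  have "realises_one_of (P - {p}) configs4"
    using p assms by (intro similar4) auto
  then show ?thesis
    using similar_or_isolated[of 4 configs4 configs5 4 4 8 P p] extends4 well_formed4 well_formed5
      card_ge_0_finite[of P] p assms by simp
qed

text \<open>Five triangles exceed the maximum on four points, which excludes an isolated
  point.\<close>

lemma similar5:
  assumes "card P = 5" "num_tri P \<ge> 5"
  shows "realises_one_of P configs5"
proof -
  from assms have "realises_one_of P configs5 \<or> (\<exists>p\<in>P. num_tri (P - {p}) = num_tri P)"
    by (intro similar5_or_isolated) auto
  then show ?thesis
  proof (elim disjE bexE)
    fix p assume "p \<in> P" "num_tri (P - {p}) = num_tri P"
    then show ?thesis using num_tri_le_4[of "P - {p}"] assms by simp
  qed
qed

lemma num_tri_le_8: "card P = 5 \<Longrightarrow> num_tri P \<le> 8"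
  using similar5[of P] similar_bound[of P configs5 5 8] well_formed5 by force

text \<open>With \<open>r\<close> isolated in \<open>P - {p}\<close>, failure would make
  \<open>p\<close> isolated in \<open>P - {r}\<close> too. Then
  \<open>isolated_points_bound\<close>, applied to the \<open>k\<close> remaining points,
  contradicts their having more than 2 triangles.\<close>

lemma remove_other_point:
  assumes Q: "card P = Suc (Suc k)" "p \<in> P" "r \<in> P - {p}" "num_tri (P - {p} - {r}) = num_tri (P - {p})"
    and cnt: "num_tri (P - {p}) > 2" "num_tri (P - {p}) + k \<le> num_tri P"
  shows "num_tri (P - {p}) < num_tri (P - {r})"
proof (rule ccontr)
  let ?K = "P - {p} - {r}"
  assume less: "\<not> ?thesis"
  have fin: "finite P" using Q(1) by (simp add: card_ge_0_finite)
  have P: "insert p (insert r ?K) = P" "insert r ?K = P - {p}" "insert p ?K = P - {r}"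
    using Q by auto
  have "num_tri ?K \<le> num_tri (P - {r})" using fin by (intro num_tri_mono) auto
  then have 1: "num_tri (insert p ?K) = num_tri ?K" using less Q(4) P(3) by simp
  have 2: "num_tri (insert r ?K) = num_tri ?K" using Q(4) by (simp only: P)
  have 3: "num_tri ?K + card ?K \<le> num_tri (insert p (insert r ?K))"
    using Q cnt fin by (simp only: P) (simp add: insert_absorb)
  have "num_tri ?K \<le> 2"
    by (rule isolated_points_bound[OF _ _ _ _ 2 1 3]) (use Q(3) fin in auto)
  then show False using Q cnt by simp
qed

lemma similar6_or_isolated:
  assumes "card P = 6" "num_tri P \<ge> 8"
  shows "realises_one_of P configs6 \<or> (\<exists>p\<in>P. num_tri (P - {p}) = num_tri P)"
proof -
  have remove: ?thesis if "realises_one_of (P - {p}) configs5" "p \<in> P" for p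
    using similar_or_isolated[of 8 configs5 configs6 5 8 11 P p] extends5 well_formed5 well_formed6
      card_ge_0_finite[of P] that assms by simp
  obtain p where p: "p \<in> P" "card (P - {p}) = 5" "6 * num_tri P \<le> 3 * num_tri P + 6 * num_tri (P - {p})"
    using remove_point[OF assms(1)] by auto
  then have "num_tri (P - {p}) \<ge> 4" using assms by simp
  with similar5_or_isolated[OF p(2)] consider "realises_one_of (P - {p}) configs5"
    | r where "r \<in> P - {p}" "num_tri (P - {p} - {r}) = num_tri (P - {p})" by auto
  then show ?thesis
  proof cases
    case 2
    \<comment> \<open>An isolated \<open>r\<close> leaves all these triangles on four points, so
      there are exactly 4. Hence \<open>p\<close> has degree at least 4, the number of points other
      than \<open>p\<close> and \<open>r\<close>, and removing \<open>r\<close> instead leaves at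
      least 5.\<close>
    then have "num_tri (P - {p}) = 4"
      using num_tri_le_4[of "P - {p} - {r}"] p \<open>num_tri (P - {p}) \<ge> 4\<close> by simp
    then have "num_tri (P - {r}) \<ge> 5"
      using remove_other_point[of P 4 p r] 2 p assms by simp
    then show ?thesis
      using remove[of r] similar5[of "P - {r}"] 2 assms by simp
  qed (use remove p in auto)
qed

lemma num_tri_le_11: 
  assumes "card P = 6"
  shows "num_tri P \<le> 11"
proof (cases "num_tri P \<ge> 8")
  case True
  from similar6_or_isolated[OF assms True] show ?thesis
  proof (elim disjE bexE)
    fix p assume "p \<in> P" "num_tri (P - {p}) = num_tri P"
    then show ?thesis using num_tri_le_8[of "P - {p}"] assms by simp
  qed (use similar_bound[of P configs6 6 11] well_formed6 in simp)
qed simp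

lemma similar7:
  assumes "card P = 7" "num_tri P \<ge> 13"
  shows "realises_one_of P configs7"
proof -
  have remove: ?thesis if "realises_one_of (P - {p}) configs6" "p \<in> P" for p
    using similar_remove[of 13 configs6 configs7 6 11 15 P p] extends6 well_formed6 well_formed7
      num_tri_le_11[of "P - {p}"] that assms by simp
  obtain p where p: "p \<in> P" "card (P - {p}) = 6" "7 * num_tri P \<le> 3 * num_tri P + 7 * num_tri (P - {p})"
    using remove_point[OF assms(1)] by auto
  then have "num_tri (P - {p}) \<ge> 8" using assms by simp
  with similar6_or_isolated[OF p(2)] consider "realises_one_of (P - {p}) configs6"
    | r where "r \<in> P - {p}" "num_tri (P - {p} - {r}) = num_tri (P - {p})" by auto
  then show ?thesis
  proof cases
    case 2
    \<comment> \<open>The same exchange one level higher: \<open>p\<close> has degree at least 5,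
      and the 9 triangles left after removing \<open>r\<close> exceed the maximum 8 on five points,
      so no point of \<open>P - {r}\<close> is isolated.\<close>
    then have "num_tri (P - {p}) = 8"
      using num_tri_le_8[of "P - {p} - {r}"] p \<open>num_tri (P - {p}) \<ge> 8\<close> by simp
    then have "9 \<le> num_tri (P - {r})"
      using remove_other_point[of P 5 p r] 2 p assms by simp
    moreover have "num_tri (P - {r} - {q}) \<le> 8" if "q \<in> P - {r}" for q
      using num_tri_le_8[of "P - {r} - {q}"] that 2 assms by simp
    ultimately have "\<not> (\<exists>q\<in>P - {r}. num_tri (P - {r} - {q}) = num_tri (P - {r}))"
      by (metis Suc_n_not_le_n eval_nat_numeral(3) le_trans)
    moreover have "card (P - {r}) = 6" "8 \<le> num_tri (P - {r})"
      using 2 assms \<open>9 \<le> num_tri (P - {r})\<close> by simp_all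
    ultimately have "realises_one_of (P - {r}) configs6"
      using similar6_or_isolated by blast
    then show ?thesis using remove 2 by simp
  qed (use remove p in auto)
qed

lemma num_tri_le_15: "card P = 7 \<Longrightarrow> num_tri P \<le> 15"
  using similar7[of P] similar_bound[of P configs7 7 15] well_formed7 by force

text \<open>Averaging leaves at least 12.5, hence 13, triangles on seven points; as these carry at
  most 15, the removed point has positive degree.\<close>

lemma similar8:
  assumes "card P = 8" "num_tri P \<ge> 20"
  shows "realises_one_of P configs8"
proof -
  obtain p where p: "p \<in> P" "card (P - {p}) = 7" "8 * num_tri P \<le> 3 * num_tri P + 8 * num_tri (P - {p})"
    using remove_point[OF assms(1)] by auto
  have "realises_one_of (P - {p}) configs7"
    using p assms by (intro similar7) auto
  then show ?thesis
    using similar_remove[of 20 configs7 configs8 7 15 20 P p] extends7 well_formed7 well_formed8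
      num_tri_le_15[OF p(2)] p assms by simp
qed

lemma num_tri_le_20: "card P = 8 \<Longrightarrow> num_tri P \<le> 20"
  using similar8[of P] similar_bound[of P configs8 8 20] well_formed8 by force

lemma num_tri_le_28:
  assumes "card P = 9"
  shows "num_tri P \<le> 28"
proof (rule ccontr)
  assume cnt: "\<not> ?thesis"
  obtain p where p: "p \<in> P" "card (P - {p}) = 8" "9 * num_tri P \<le> 3 * num_tri P + 9 * num_tri (P - {p})"
    using remove_point[OF assms(1)] by auto
  have "realises_one_of (P - {p}) configs8"
    using p cnt by (intro similar8) auto
  then have "realises_one_of P []"
    using similar_remove[of 29 configs8 "[]" 8 20 0 P p] extends8 well_formed8
      num_tri_le_20[OF p(2)] p cnt by simp
  then show False by (simp add: realises_one_of_def)
qed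

section \<open>Point sets attaining the maxima\<close>

lemma attained:
  assumes "list_all (well_formed n (int m)) [C]" "triangles (base C) = int m"
  shows "\<exists>P. finite P \<and> card P = n \<and> num_tri P = m"
proof -
  let ?P = "(\<lambda>c. 0 + 1 * emb c) ` set (base C)"
  have "realises ?P C"
    unfolding realises_def using zero_neq_one by metis
  then have "card ?P = n \<and> num_tri ?P = m"
    using realises_num_tri[of ?P C n "int m"] assms by simp
  then show ?thesis by blast
qed

theorem theorem5:
  shows "S_tri 3 = 1 \<and> S_tri 4 = 4 \<and> S_tri 5 = 8 \<and> S_tri 6 = 11 \<and>
         S_tri 7 = 15 \<and> S_tri 8 = 20 \<and> S_tri 9 = 28"
proof (intro conjI)
  \<comment> \<open>The witnesses are a right triangle, the unit square, the centre of a 3 by 3 grid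
    with its four neighbours, and then this cross with one, two, three and four corners of the grid
    added.\<close>
  show "S_tri 3 = 1"
    by (rule S_tri_eqI[OF num_tri_le_1 attained[of _ _ "[(0,1)]"]], assumption) code_simp+
  show "S_tri 4 = 4"
    by (rule S_tri_eqI[OF num_tri_le_4 attained[of _ _ "[(0,1),(1,1)]"]], assumption) code_simp+
  show "S_tri 5 = 8"
    by (rule S_tri_eqI[OF num_tri_le_8 attained[of _ _ "[(0,1),(-1,0),(0,-1)]"]], assumption) code_simp+
  show "S_tri 6 = 11"
    by (rule S_tri_eqI[OF num_tri_le_11 attained[of _ _ "[(0,1),(-1,0),(0,-1),(1,1)]"]], assumption) code_simp+
  show "S_tri 7 = 15"
    by (rule S_tri_eqI[OF num_tri_le_15 attained[of _ _ "[(0,1),(-1,0),(0,-1),(1,1),(-1,1)]"]], assumption) code_simp+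
  show "S_tri 8 = 20"
    by (rule S_tri_eqI[OF num_tri_le_20 attained[of _ _ "[(0,1),(-1,0),(0,-1),(1,1),(-1,1),(1,-1)]"]], assumption) code_simp+
  show "S_tri 9 = 28"
    by (rule S_tri_eqI[OF num_tri_le_28 attained[of _ _ "[(0,1),(-1,0),(0,-1),(1,1),(-1,1),(1,-1),(-1,-1)]"]], assumption) code_simp+
qed

end
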